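(* Let $n\ge 1$. For every permutation $\pi\in S_n$ with inversion graph $G_\pi$, \[ \beta(G_\pi) \le \ell(\pi) - \ell'(\pi) \le 2\beta(G_\pi). \]
   Context: The Coxeter length $\ell(\pi)$ is the minimum number of simple reflections $s_i=(i,i+1)$, $1\le i\le n-1$, in a product expression for $\pi$. The reflection length $\ell'(\pi)$ is the minimum number of arbitrary transpositions $(i,j)$ in a product expression for $\pi$. Inversion graph: $G_\pi$ is the simple graph with vertex set $[n]=\{1,\dots,n\}$ (the values of $\pi$) in which values $a<b$ are adjacent if and only if $b$ appears to the left of $a$ in the one-line notation $\pi(1)\cdots\pi(n)$, i.e. $\pi^{-1}(b)<\pi^{-1}(a)$. Cyclomatic number: $\beta(G) = |E(G)| - |V(G)| + \kappa(G)$, where $\kappa(G)$ is the number of connected components of the graph $G$. *)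

theory Defs
  imports "HOL-Combinatorics.Permutations"
begin

definition word_length :: "('a \<Rightarrow> 'a) set \<Rightarrow> ('a \<Rightarrow> 'a) \<Rightarrow> nat" where
  "word_length S \<pi> = (LEAST k. \<exists>ws. length ws = k \<and> set ws \<subseteq> S \<and> \<pi> = foldr (\<circ>) ws id)"

definition simple_reflections :: "nat \<Rightarrow> (nat \<Rightarrow> nat) set" where
  "simple_reflections n = {transpose i (i + 1) | i. 1 \<le> i \<and> i + 1 \<le> n}"

definition transpositions :: "nat \<Rightarrow> (nat \<Rightarrow> nat) set" where
  "transpositions n = {transpose i j | i j. 1 \<le> i \<and> i < j \<and> j \<le> n}"

definition coxeter_length :: "nat \<Rightarrow> (nat \<Rightarrow> nat) \<Rightarrow> nat" where
  "coxeter_length n \<pi> = word_length (simple_reflections n) \<pi>"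

definition reflection_length :: "nat \<Rightarrow> (nat \<Rightarrow> nat) \<Rightarrow> nat" where
  "reflection_length n \<pi> = word_length (transpositions n) \<pi>"

text \<open>A finite simple graph is a pair of a finite vertex set \<open>V\<close> and a set \<open>E\<close> of two-element
  subsets of \<open>V\<close>.  Its connected components are the classes, on \<open>V\<close>, of the reachability relation.\<close>

type_synonym 'a sgraph = "'a set \<times> 'a set set"

definition components :: "'a sgraph \<Rightarrow> 'a set set" where
  "components G = fst G // {(u, v). {u, v} \<in> snd G}\<^sup>*"

definition cyclomatic_number :: "'a sgraph \<Rightarrow> int" where
  "cyclomatic_number G = int (card (snd G)) - int (card (fst G)) + int (card (components G))"

definition inversion_graph :: "nat \<Rightarrow> (nat \<Rightarrow> nat) \<Rightarrow> nat sgraph" where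
  "inversion_graph n \<pi> =
    ({1..n}, {{a, b} | a b. a \<in> {1..n} \<and> b \<in> {1..n} \<and> a < b \<and> inv \<pi> b < inv \<pi> a})"

end

theory Submission
  imports Defs
begin

text \<open>
  Write \<open>E\<close> for the edge set and \<open>\<kappa>\<close> for the number of components of the inversion graph of \<open>\<pi>\<close>.
  The edges are the inversions of \<open>\<pi>\<close>, so \<open>\<ell>(\<pi>) = |E|\<close> by the usual bubble sort argument, and the
  two inequalities become \<open>\<ell>'(\<pi>) \<le> n - \<kappa>\<close> and \<open>\<ell>(\<pi>) + \<ell>'(\<pi>) \<ge> 2 (n - \<kappa>)\<close>.

  For the first one, every value \<open>\<pi> x\<close> lies in the component of \<open>x\<close>
  (\<open>reachable_image\<close>), and a permutation that preserves the classes of a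
  partition is sorted by one transposition for each element that is not a chosen representative of
  its class (\<open>colour_preserving_permutation_word\<close>).

  For the second one, let \<open>S\<close> be the set of those \<open>i\<close> for which \<open>s\<^sub>i\<close> occurs in a reduced word of
  \<open>\<pi>\<close>. If \<open>i \<notin> S\<close>, then no edge joins \<open>{1..i}\<close> to its complement, hence \<open>\<kappa> \<ge> n - |S|\<close>, and it is
  enough to show \<open>\<ell> + \<ell>' \<ge> 2 |S|\<close>. Take the graph whose edges are the transpositions of a
  shortest factorization of \<open>\<pi>\<close>, together with one edge \<open>{i, i + 1}\<close> for each letter of the reduced
  word that is repeated later on; it has at most \<open>\<ell>' + \<ell> - |S|\<close> edges. Colour the vertices by its
  components. Then \<open>\<pi>\<close> preserves colours. Peeling the letters off the word from the left keeps this
  property and shows that \<open>i\<close> and \<open>i + 1\<close> have the same colour for all \<open>i \<in> S\<close>: a repeated letter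
  does so by the choice of the graph, and the last occurrence of a letter because it merges two
  cycles (\<open>colours_merge\<close>). So there are at most \<open>n - |S|\<close> colours, and since a graph with \<open>m\<close>
  edges has at least \<open>n - m\<close> components, \<open>|S| \<le> \<ell>' + \<ell> - |S|\<close>.

  Partitions are represented throughout by colourings, that is, by functions \<open>f\<close> constant on the
  classes, so that the number of classes in \<open>V\<close> is \<open>card (f ` V)\<close>.
\<close>

section \<open>Words and word length\<close>

definition word_product :: "('a \<Rightarrow> 'a) list \<Rightarrow> 'a \<Rightarrow> 'a" where
  "word_product ws = foldr (\<circ>) ws id"

lemma word_product_simps [simp]:
  "word_product [] = id" "word_product (w # ws) = w \<circ> word_product ws"
  by (simp_all only: word_product_def foldr.simps comp_apply id_apply)

abbreviation adjacent_swap :: "nat \<Rightarrow> nat \<Rightarrow> nat" where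
  "adjacent_swap i \<equiv> transpose i (Suc i)"

lemma word_length_le:
  assumes "set ws \<subseteq> S"
  shows "word_length S (word_product ws) \<le> length ws"
  unfolding word_length_def word_product_def using assms by (intro Least_le) blast

lemma obtain_shortest_word:
  assumes "set ws \<subseteq> S" and "\<pi> = word_product ws"
  obtains vs where "length vs = word_length S \<pi>" and "set vs \<subseteq> S" and "\<pi> = word_product vs"
proof -
  have "\<exists>k vs. length vs = k \<and> set vs \<subseteq> S \<and> \<pi> = word_product vs"
    using assms unfolding word_product_def by blast
  from LeastI_ex[OF this] show ?thesis
    using that unfolding word_length_def word_product_def by blast
qed

lemma simple_reflections_word:
  assumes "set ws \<subseteq> simple_reflections n"
  obtains idx where "ws = map adjacent_swap idx" and "set idx \<subseteq> {1..<n}"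
proof -
  have "\<exists>idx. ws = map adjacent_swap idx \<and> set idx \<subseteq> {1..<n}"
    using assms
  proof (induction ws)
    case Nil
    show ?case by simp
  next
    case (Cons w ws)
    then obtain idx where "ws = map adjacent_swap idx" "set idx \<subseteq> {1..<n}" by auto
    moreover obtain i where "w = adjacent_swap i" "i \<in> {1..<n}"
      using Cons.prems by (auto simp: simple_reflections_def)
    ultimately show ?case by (intro exI[of _ "i # idx"]) auto
  qed
  then show ?thesis using that by blast
qed

lemma adjacent_swaps_in_simple_reflections:
  "set idx \<subseteq> {1..<n} \<Longrightarrow> set (map adjacent_swap idx) \<subseteq> simple_reflections n"
  by (fastforce simp: simple_reflections_def)

lemma bij_adjacent_swap_product: "bij (word_product (map adjacent_swap idx))"
  by (induction idx) (simp_all add: bij_comp bij_id del: id_apply comp_apply)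

text \<open>Only the letter \<open>i\<close> moves anything across the cut between \<open>i\<close> and \<open>i + 1\<close>.\<close>

lemma adjacent_swap_product_le_iff:
  assumes "i \<notin> set idx"
  shows "word_product (map adjacent_swap idx) z \<le> i \<longleftrightarrow> z \<le> i"
  using assms
proof (induction idx)
  case Nil
  show ?case by simp
next
  case (Cons j js)
  then have "adjacent_swap j y \<le> i \<longleftrightarrow> y \<le> i" for y
    by (auto simp: transpose_def)
  with Cons show ?case by simp
qed

section \<open>Coxeter length counts inversions\<close>

definition inversions :: "nat \<Rightarrow> (nat \<Rightarrow> nat) \<Rightarrow> (nat \<times> nat) set" where
  "inversions n q = {(a, b). a \<in> {1..n} \<and> b \<in> {1..n} \<and> a < b \<and> q b < q a}"

lemma finite_inversions [simp]: "finite (inversions n q)"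
  by (rule finite_subset[of _ "{1..n} \<times> {1..n}"]) (auto simp: inversions_def)

lemma card_edges_inversion_graph:
  "card (snd (inversion_graph n \<pi>)) = card (inversions n (inv \<pi>))"
proof -
  have "snd (inversion_graph n \<pi>) = (\<lambda>(a, b). {a, b}) ` inversions n (inv \<pi>)"
    by (auto simp: inversion_graph_def inversions_def)
  moreover have "inj_on (\<lambda>(a, b). {a, b}) (inversions n (inv \<pi>))"
    by (auto simp: inj_on_def inversions_def doubleton_eq_iff)
  ultimately show ?thesis by (simp add: card_image)
qed

text \<open>An adjacent swap reverses the order of no pair of arguments except \<open>(i, i + 1)\<close>, so moving
  both entries of a pair by it matches the remaining inversions of the two functions.\<close>

lemma card_inversions_adjacent_swap_away:
  assumes "i \<in> {1..<n}"
  shows "card (inversions n (q \<circ> adjacent_swap i) - {(i, Suc i)})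
    = card (inversions n q - {(i, Suc i)})"
proof -
  have le: "card (inversions n q - {(i, Suc i)})
      \<le> card (inversions n (q \<circ> adjacent_swap i) - {(i, Suc i)})" for q
  proof (rule card_inj_on_le)
    show "inj_on (map_prod (adjacent_swap i) (adjacent_swap i)) (inversions n q - {(i, Suc i)})"
      by (rule inj_on_subset[OF prod.inj_map]) auto
    show "map_prod (adjacent_swap i) (adjacent_swap i) ` (inversions n q - {(i, Suc i)})
        \<subseteq> inversions n (q \<circ> adjacent_swap i) - {(i, Suc i)}"
    proof (rule image_subsetI)
      fix e assume "e \<in> inversions n q - {(i, Suc i)}"
      then obtain a b where e: "e = (a, b)"
        and ab: "(a, b) \<in> inversions n q" "(a, b) \<noteq> (i, Suc i)"
        by (cases e) auto
      then have "adjacent_swap i a < adjacent_swap i b"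
        by (auto simp: inversions_def transpose_def)
      moreover have "adjacent_swap i a \<in> {1..n}" "adjacent_swap i b \<in> {1..n}"
        using ab assms by (auto simp: inversions_def transpose_def)
      moreover have "(adjacent_swap i a, adjacent_swap i b) \<noteq> (i, Suc i)"
        using ab by (auto simp: inversions_def transpose_def split: if_splits)
      ultimately show "map_prod (adjacent_swap i) (adjacent_swap i) e
          \<in> inversions n (q \<circ> adjacent_swap i) - {(i, Suc i)}"
        using ab by (simp add: e inversions_def)
    qed
  qed simp
  from le[of q] le[of "q \<circ> adjacent_swap i"] show ?thesis
    by (simp add: comp_assoc)
qed

lemma card_inversions_adjacent_swap_le:
  assumes "i \<in> {1..<n}"
  shows "card (inversions n (q \<circ> adjacent_swap i)) \<le> Suc (card (inversions n q))"
proof -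
  have "card (inversions n (q \<circ> adjacent_swap i))
      \<le> Suc (card (inversions n (q \<circ> adjacent_swap i) - {(i, Suc i)}))"
    by (metis card_Diff1_le card_Suc_Diff1 diff_card_le_card_Diff finite_inversions
        le_SucI le_refl Diff_empty Diff_insert0)
  also have "\<dots> \<le> Suc (card (inversions n q))"
    unfolding card_inversions_adjacent_swap_away[OF assms] by (simp add: card_Diff1_le)
  finally show ?thesis .
qed

lemma card_inversions_adjacent_swap_descent:
  assumes "i \<in> {1..<n}" and "q (Suc i) < q i"
  shows "card (inversions n q) = Suc (card (inversions n (q \<circ> adjacent_swap i)))"
proof -
  have "(i, Suc i) \<in> inversions n q" "(i, Suc i) \<notin> inversions n (q \<circ> adjacent_swap i)"
    using assms by (auto simp: inversions_def)
  then show ?thesis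
    using card_inversions_adjacent_swap_away[OF assms(1), of q]
    by (metis Diff_empty Diff_insert0 card_Suc_Diff1 finite_inversions)
qed

text \<open>A permutation without descents is strictly increasing on all of \<open>\<nat>\<close>, and so is its inverse;
  a strictly increasing function on \<open>\<nat>\<close> never lies below the identity.\<close>

lemma permutes_no_descent_imp_id:
  assumes q: "q permutes {1..n}" and no_descent: "\<And>i. i \<in> {1..<n} \<Longrightarrow> \<not> q (Suc i) < q i"
  shows "q = id"
proof -
  have "q i < q (Suc i)" for i
  proof (cases "i \<in> {1..<n}")
    case True
    with no_descent[of i] permutes_inj[OF q] show ?thesis
      by (metis inj_eq n_not_Suc_n nat_neq_iff)
  next
    case False
    \<comment> \<open>Here \<open>i = 0\<close> or \<open>i \<ge> n\<close>, where \<open>q\<close> maps each of \<open>{0}\<close>, \<open>{1..n}\<close> and \<open>{n<..}\<close> to itself.\<close>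
    show ?thesis
    proof (cases "i = 0")
      case True
      have "q 0 = 0" using permutes_not_in[OF q, of 0] by simp
      with True permutes_inj[OF q] show ?thesis
        by (metis inj_eq n_not_Suc_n not_gr_zero)
    next
      case i: False
      with False have Suc_i: "q (Suc i) = Suc i" using permutes_not_in[OF q, of "Suc i"] by simp
      have "q i \<le> i"
        using i False permutes_not_in[OF q, of i] permutes_in_image[OF q, of i] by (cases "i = n") auto
      with Suc_i show ?thesis by simp
    qed
  qed
  then have mono: "strict_mono q" by (simp add: strict_mono_Suc_iff)
  have "q i = i" for i
  proof (rule antisym)
    show "i \<le> q i" using mono by (rule strict_mono_imp_increasing)
    have "strict_mono (inv q)"
    proof (rule strict_monoI)
      fix x y :: nat assume "x < y"
      then show "inv q x < inv q y"
        using strict_mono_less[OF mono] permutes_inverses(1)[OF q] by metis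
    qed
    then have "q i \<le> inv q (q i)" by (rule strict_mono_imp_increasing)
    then show "q i \<le> i" using permutes_inverses(2)[OF q] by simp
  qed
  then show ?thesis by auto
qed

lemma permutes_adjacent_swap: "i \<in> {1..<n} \<Longrightarrow> adjacent_swap i permutes {1..n}"
  by (rule permutes_swap_id) auto

text \<open>Bubble sort: remove a descent until none is left.\<close>

lemma permutation_word_of_inversions:
  assumes "\<pi> permutes {1..n}"
  obtains idx where "set idx \<subseteq> {1..<n}" and "\<pi> = word_product (map adjacent_swap idx)"
    and "length idx = card (inversions n (inv \<pi>))"
proof -
  have "\<exists>idx. set idx \<subseteq> {1..<n} \<and> \<pi> = word_product (map adjacent_swap idx)
      \<and> length idx = card (inversions n (inv \<pi>))"
    using assms
  proof (induction "card (inversions n (inv \<pi>))" arbitrary: \<pi> rule: less_induct)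
    case less
    show ?case
    proof (cases "\<exists>i\<in>{1..<n}. inv \<pi> (Suc i) < inv \<pi> i")
      case False
      then have "inv \<pi> = id"
        using permutes_no_descent_imp_id[OF permutes_inv[OF less.prems]] by blast
      then have "\<pi> = id" by (metis inv_id permutes_inv_inv[OF less.prems])
      moreover have "inversions n id = {}" by (auto simp: inversions_def)
      ultimately show ?thesis by (intro exI[of _ "[]"]) simp
    next
      case True
      then obtain i where i: "i \<in> {1..<n}" and desc: "inv \<pi> (Suc i) < inv \<pi> i" by blast
      define \<sigma> where "\<sigma> = adjacent_swap i \<circ> \<pi>"
      have \<sigma>: "\<sigma> permutes {1..n}"
        unfolding \<sigma>_def by (rule permutes_compose[OF less.prems permutes_adjacent_swap[OF i]])
      have inv_\<sigma>: "inv \<sigma> = inv \<pi> \<circ> adjacent_swap i"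
        unfolding \<sigma>_def using permutes_bij[OF less.prems] by (subst o_inv_distrib) simp_all
      have \<pi>: "\<pi> = adjacent_swap i \<circ> \<sigma>"
        unfolding \<sigma>_def by (simp add: comp_assoc[symmetric])
      have card: "card (inversions n (inv \<pi>)) = Suc (card (inversions n (inv \<sigma>)))"
        unfolding inv_\<sigma> by (rule card_inversions_adjacent_swap_descent[where q = "inv \<pi>", OF i desc])
      from less.hyps[of \<sigma>] card \<sigma> obtain idx where "set idx \<subseteq> {1..<n}"
        "\<sigma> = word_product (map adjacent_swap idx)" "length idx = card (inversions n (inv \<sigma>))"
        by auto
      with card i \<pi> show ?thesis by (intro exI[of _ "i # idx"]) simp
    qed
  qed
  then show ?thesis using that by blast
qed

lemma card_inversions_le_length:
  assumes "set idx \<subseteq> {1..<n}"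
  shows "card (inversions n (inv (word_product (map adjacent_swap idx)))) \<le> length idx"
  using assms
proof (induction idx)
  case Nil
  have "inversions n id = {}" by (auto simp: inversions_def)
  then show ?case by (simp del: id_apply)
next
  case (Cons i idx)
  have "inv (word_product (map adjacent_swap (i # idx)))
      = inv (word_product (map adjacent_swap idx)) \<circ> adjacent_swap i"
    by (simp add: o_inv_distrib bij_adjacent_swap_product)
  then show ?case
    using Cons card_inversions_adjacent_swap_le[of i n "inv (word_product (map adjacent_swap idx))"]
    by (simp del: comp_apply)
qed

lemma obtain_reduced_word:
  assumes "\<pi> permutes {1..n}"
  obtains idx where "set idx \<subseteq> {1..<n}" and "\<pi> = word_product (map adjacent_swap idx)"
    and "length idx = coxeter_length n \<pi>"
    and "coxeter_length n \<pi> = card (inversions n (inv \<pi>))"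
proof -
  obtain js where js: "set js \<subseteq> {1..<n}" "\<pi> = word_product (map adjacent_swap js)"
      "length js = card (inversions n (inv \<pi>))"
    using permutation_word_of_inversions[OF assms] .
  have le: "coxeter_length n \<pi> \<le> card (inversions n (inv \<pi>))"
    using word_length_le[OF adjacent_swaps_in_simple_reflections[OF js(1)]] js(2,3)
    by (simp add: coxeter_length_def)
  obtain ws where ws: "length ws = coxeter_length n \<pi>" "set ws \<subseteq> simple_reflections n"
      "\<pi> = word_product ws"
    using obtain_shortest_word[OF adjacent_swaps_in_simple_reflections[OF js(1)] js(2)]
    unfolding coxeter_length_def .
  obtain idx where idx: "ws = map adjacent_swap idx" "set idx \<subseteq> {1..<n}"
    using simple_reflections_word[OF ws(2)] .
  have "card (inversions n (inv \<pi>)) \<le> coxeter_length n \<pi>"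
    using card_inversions_le_length[OF idx(2)] ws idx by simp
  with le ws idx that show ?thesis by auto
qed

section \<open>Components of the inversion graph\<close>

definition reachable :: "nat \<Rightarrow> (nat \<Rightarrow> nat) \<Rightarrow> (nat \<times> nat) set" where
  "reachable n \<pi> = {(u, v). {u, v} \<in> snd (inversion_graph n \<pi>)}\<^sup>*"

lemma reachable_sym: "(x, y) \<in> reachable n \<pi> \<Longrightarrow> (y, x) \<in> reachable n \<pi>"
  unfolding reachable_def
  by (rule symD[OF sym_rtrancl]) (auto simp: sym_def insert_commute)

lemma reachable_trans:
  "(x, y) \<in> reachable n \<pi> \<Longrightarrow> (y, z) \<in> reachable n \<pi> \<Longrightarrow> (x, z) \<in> reachable n \<pi>"
  unfolding reachable_def by (rule rtrancl_trans)

lemma reachable_inversion: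
  assumes "a \<in> {1..n}" "b \<in> {1..n}" "a < b" "inv \<pi> b < inv \<pi> a"
  shows "(a, b) \<in> reachable n \<pi>"
proof -
  have "{a, b} \<in> snd (inversion_graph n \<pi>)"
    unfolding inversion_graph_def snd_conv
    by (rule CollectI, rule exI[of _ a], rule exI[of _ b]) (use assms in simp)
  then show ?thesis unfolding reachable_def by (intro r_into_rtrancl) simp
qed

lemma components_eq_image:
  "components (inversion_graph n \<pi>) = (\<lambda>x. reachable n \<pi> `` {x}) ` {1..n}"
  unfolding components_def reachable_def quotient_def by (auto simp: inversion_graph_def)

text \<open>If \<open>\<pi>\<close> does not preserve \<open>{1..i}\<close>, then by counting some value \<open>b > i\<close> sits in the first \<open>i\<close>
  positions and some value \<open>a \<le> i\<close> behind them. Wherever \<open>i\<close> and \<open>i + 1\<close> are placed, they are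
  adjacent or each is joined to \<open>a\<close> or to \<open>b\<close>, and \<open>a\<close> is adjacent to \<open>b\<close>.\<close>

lemma reachable_Suc_if_not_cut:
  assumes \<pi>: "\<pi> permutes {1..n}" and i: "i \<in> {1..<n}"
    and not_cut: "\<pi> ` {1..i} \<noteq> {1..i}"
  shows "(i, Suc i) \<in> reachable n \<pi>"
proof -
  let ?q = "inv \<pi>"
  have q: "?q permutes {1..n}" using \<pi> by (rule permutes_inv)
  have "\<not> \<pi> ` {1..i} \<subseteq> {1..i}"
    using endo_inj_surj[of "{1..i}" \<pi>] not_cut permutes_inj_on[OF \<pi>] by auto
  then obtain x where x: "x \<in> {1..i}" "\<pi> x \<notin> {1..i}" by blast
  define b where "b = \<pi> x"
  have b: "b \<in> {1..n}" "i < b" "?q b \<le> i"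
    using x i permutes_in_image[OF \<pi>, of x] permutes_inverses(2)[OF \<pi>, of x]
    by (auto simp: b_def)
  have "\<not> ?q ` {1..i} \<subseteq> {1..i}"
  proof
    assume "?q ` {1..i} \<subseteq> {1..i}"
    then have "?q ` {1..i} = {1..i}"
      using endo_inj_surj[of "{1..i}" ?q] permutes_inj_on[OF q] by auto
    then have "\<pi> ` {1..i} = \<pi> ` ?q ` {1..i}" by simp
    also have "\<dots> = {1..i}" using permutes_inverses(1)[OF \<pi>] by (simp add: image_image)
    finally show False using not_cut by simp
  qed
  then obtain a where "a \<in> {1..i}" "?q a \<notin> {1..i}" by blast
  then have a: "a \<in> {1..n}" "a \<le> i" "i < ?q a"
    using i permutes_in_image[OF q, of a] by auto
  have ab: "(a, b) \<in> reachable n \<pi>"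
    using a b by (intro reachable_inversion) auto
  have in_range: "i \<in> {1..n}" "Suc i \<in> {1..n}" using i by auto
  have i_ab: "(i, a) \<in> reachable n \<pi> \<or> (i, b) \<in> reachable n \<pi>"
  proof (cases "?q i \<le> i")
    case True
    then have "a \<noteq> i" using a by auto
    with True show ?thesis
      using a in_range by (intro disjI1 reachable_sym[OF reachable_inversion]) auto
  next
    case False
    then show ?thesis using b in_range by (intro disjI2 reachable_inversion) auto
  qed
  have "(Suc i, a) \<in> reachable n \<pi> \<or> (Suc i, b) \<in> reachable n \<pi>"
  proof (cases "?q (Suc i) \<le> i")
    case True
    then show ?thesis
      using a in_range by (intro disjI1 reachable_sym[OF reachable_inversion]) auto
  next
    case False
    then have "b \<noteq> Suc i" using b by auto
    with False show ?thesis using b in_range by (intro disjI2 reachable_inversion) auto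
  qed
  then have "(Suc i, a) \<in> reachable n \<pi>"
    using reachable_trans[OF _ reachable_sym[OF ab]] by blast
  then have Suc_i_a: "(a, Suc i) \<in> reachable n \<pi>" by (rule reachable_sym)
  have "(i, a) \<in> reachable n \<pi>"
    using i_ab reachable_trans[OF _ reachable_sym[OF ab]] by blast
  then show ?thesis using Suc_i_a by (rule reachable_trans)
qed

lemma reachable_interval:
  assumes "x \<le> y" and "\<And>i. x \<le> i \<Longrightarrow> i < y \<Longrightarrow> (i, Suc i) \<in> reachable n \<pi>"
  shows "(x, y) \<in> reachable n \<pi>"
  using assms
proof (induction y rule: dec_induct)
  case base
  show ?case by (simp add: reachable_def)
next
  case (step y)
  then have "(x, y) \<in> reachable n \<pi>" "(y, Suc y) \<in> reachable n \<pi>" by auto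
  then show ?case by (rule reachable_trans)
qed

text \<open>For every \<open>i\<close> between \<open>x\<close> and \<open>\<pi> x\<close> the set \<open>{1..i}\<close> contains exactly one of the two, so it
  is not preserved by \<open>\<pi>\<close>.\<close>

lemma reachable_image:
  assumes \<pi>: "\<pi> permutes {1..n}" and x: "x \<in> {1..n}"
  shows "(x, \<pi> x) \<in> reachable n \<pi>"
proof -
  have \<pi>x: "\<pi> x \<in> {1..n}" using permutes_in_image[OF \<pi>] x by blast
  show ?thesis
  proof (cases "x \<le> \<pi> x")
    case True
    then show ?thesis
    proof (rule reachable_interval)
      fix i assume i: "x \<le> i" "i < \<pi> x"
      then have "\<pi> x \<in> \<pi> ` {1..i}" "\<pi> x \<notin> {1..i}" using x by auto
      then have "\<pi> ` {1..i} \<noteq> {1..i}" by blast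
      then show "(i, Suc i) \<in> reachable n \<pi>"
        using i x \<pi>x by (intro reachable_Suc_if_not_cut[OF \<pi>]) auto
    qed
  next
    case False
    have "(\<pi> x, x) \<in> reachable n \<pi>"
    proof (rule reachable_interval)
      fix i assume i: "\<pi> x \<le> i" "i < x"
      then have "\<pi> x \<notin> \<pi> ` {1..i}" "\<pi> x \<in> {1..i}"
        using \<pi>x by (auto simp: inj_image_mem_iff[OF permutes_inj[OF \<pi>]])
      then have "\<pi> ` {1..i} \<noteq> {1..i}" by blast
      then show "(i, Suc i) \<in> reachable n \<pi>"
        using i x \<pi>x by (intro reachable_Suc_if_not_cut[OF \<pi>]) auto
    qed (use False in simp)
    then show ?thesis by (rule reachable_sym)
  qed
qed

text \<open>The letters missing from a word cut the inversion graph: if \<open>i < j\<close> are two elements of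
  \<open>{1..n} - set idx\<close>, then the cut after \<open>i\<close> separates them. The element \<open>n\<close>, which is never a letter,
  stands for the last component.\<close>

lemma card_components_ge:
  assumes \<pi>: "\<pi> = word_product (map adjacent_swap idx)" and idx: "set idx \<subseteq> {1..<n}"
  shows "n \<le> card (components (inversion_graph n \<pi>)) + card (set idx)"
proof -
  let ?C = "\<lambda>x. reachable n \<pi> `` {x}"
  have bij: "bij \<pi>" unfolding \<pi> by (rule bij_adjacent_swap_product)
  have cut: "y \<le> i" if "i \<notin> set idx" "(x, y) \<in> reachable n \<pi>" "x \<le> i" for i x y
    using that(2,3) unfolding reachable_def
  proof (induction rule: rtrancl_induct)
    case base
    then show ?case .
  next
    case (step y z)
    have inv_le: "inv \<pi> v \<le> i \<longleftrightarrow> v \<le> i" for v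
      using adjacent_swap_product_le_iff[OF that(1), of "inv \<pi> v"]
      by (simp add: \<pi>[symmetric] surj_f_inv_f[OF bij_is_surj[OF bij]])
    from step.hyps(2) have "z < y \<or> inv \<pi> z < inv \<pi> y"
      by (auto simp: inversion_graph_def doubleton_eq_iff)
    with step.IH[OF step.prems] inv_le[of y] inv_le[of z] show ?case by linarith
  qed
  have "inj_on ?C ({1..n} - set idx)"
  proof (rule linorder_inj_onI)
    fix i j assume ij: "i < j" "i \<in> {1..n} - set idx"
    have "j \<in> ?C j" by (simp add: reachable_def)
    moreover have "j \<notin> ?C i" using cut[of i i j] ij by auto
    ultimately show "?C i \<noteq> ?C j" by blast
  qed auto
  then have "card ({1..n} - set idx) = card (?C ` ({1..n} - set idx))" by (simp add: card_image)
  also have "\<dots> \<le> card (components (inversion_graph n \<pi>))"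
    unfolding components_eq_image by (intro card_mono) auto
  finally have "card ({1..n} - set idx) \<le> card (components (inversion_graph n \<pi>))" .
  moreover have "set idx \<subseteq> {1..n}" using idx by auto
  then have "card ({1..n} - set idx) = n - card (set idx)"
    by (simp add: card_Diff_subset)
  ultimately show ?thesis by linarith
qed

section \<open>Sorting within the classes of a partition\<close>

text \<open>If \<open>p\<close> moves \<open>x\<close>, then composing it with the transposition of \<open>x\<close> and \<open>p x\<close> makes \<open>x\<close> a fixed
  point, which can be dropped from \<open>V\<close>. No colour is lost, because \<open>p x\<close> has the colour of \<open>x\<close>. So
  each step lowers \<open>card V - card (f ` V)\<close> by one.\<close>

lemma colour_preserving_permutation_word:
  assumes "finite V" and "p permutes V" and "\<And>x. x \<in> V \<Longrightarrow> f (p x) = f x"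
  obtains ws where "set ws \<subseteq> {transpose a b | a b. a \<in> V \<and> b \<in> V \<and> a \<noteq> b}"
    and "p = word_product ws" and "length ws + card (f ` V) \<le> card V"
proof -
  have "\<exists>ws. set ws \<subseteq> {transpose a b | a b. a \<in> V \<and> b \<in> V \<and> a \<noteq> b}
      \<and> p = word_product ws \<and> length ws + card (f ` V) \<le> card V"
    using assms
  proof (induction V arbitrary: p rule: finite_psubset_induct)
    case (psubset V)
    note p = psubset.prems(1)
    show ?case
    proof (cases "p = id")
      case True
      then show ?thesis using card_image_le[OF psubset.hyps] by (intro exI[of _ "[]"]) auto
    next
      case False
      then obtain x where x: "p x \<noteq> x" by fastforce
      then have xV: "x \<in> V" "p x \<in> V"
        using permutes_not_in[OF p] permutes_in_image[OF p] by auto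
      define r where "r = transpose x (p x) \<circ> p"
      have r_x: "r x = x" by (simp add: r_def)
      have r_V: "r permutes V"
        unfolding r_def using xV by (intro permutes_compose[OF p] permutes_swap_id)
      have r: "r permutes (V - {x})"
        by (rule permutes_superset[OF r_V]) (use r_x in auto)
      have f_r: "f (r z) = f z" if "z \<in> V - {x}" for z
        using psubset.prems(2)[of z] psubset.prems(2)[of x] that xV
        by (auto simp: r_def transpose_def)
      from psubset.IH[OF _ r f_r] xV obtain ws
        where ws: "set ws \<subseteq> {transpose a b | a b. a \<in> V - {x} \<and> b \<in> V - {x} \<and> a \<noteq> b}"
          "r = word_product ws" "length ws + card (f ` (V - {x})) \<le> card (V - {x})"
        by blast
      have "f x \<in> f ` (V - {x})"
        using psubset.prems(2)[OF xV(1)] xV x by (metis DiffI image_eqI singletonD)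
      then have img: "f ` (V - {x}) = f ` V" by blast
      have "p = transpose x (p x) \<circ> r" by (simp add: r_def comp_assoc[symmetric])
      then have "p = word_product (transpose x (p x) # ws)" using ws(2) by simp
      moreover have "card V = Suc (card (V - {x}))"
        using xV psubset.hyps by (metis card_Suc_Diff1)
      moreover have "set (transpose x (p x) # ws)
          \<subseteq> {transpose a b | a b. a \<in> V \<and> b \<in> V \<and> a \<noteq> b}"
      proof -
        have "transpose x (p x) \<in> {transpose a b | a b. a \<in> V \<and> b \<in> V \<and> a \<noteq> b}"
          using xV x by (metis (mono_tags, lifting) mem_Collect_eq)
        moreover have "set ws \<subseteq> {transpose a b | a b. a \<in> V \<and> b \<in> V \<and> a \<noteq> b}"
          using ws(1) by blast
        ultimately show ?thesis by simp
      qed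
      ultimately show ?thesis using ws(3) img
        by (intro exI[of _ "transpose x (p x) # ws"]) simp
    qed
  qed
  then show ?thesis using that by blast
qed

lemma transpositions_eq:
  "{transpose a b | a b. a \<in> {1..n} \<and> b \<in> {1..n} \<and> a \<noteq> b} = transpositions n"
proof
  show "{transpose a b | a b. a \<in> {1..n} \<and> b \<in> {1..n} \<and> a \<noteq> b} \<subseteq> transpositions n"
  proof clarify
    fix a b assume ab: "a \<in> {1..n}" "b \<in> {1..n}" "a \<noteq> b"
    then have "transpose a b = transpose (min a b) (max a b)"
      by (auto simp: min_def max_def transpose_commute)
    moreover have "1 \<le> min a b" "min a b < max a b" "max a b \<le> n" using ab by auto
    ultimately show "transpose a b \<in> transpositions n"
      unfolding transpositions_def by blast
  qed
qed (fastforce simp: transpositions_def)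

text \<open>The colours are the components of the inversion graph, which \<open>\<pi>\<close> preserves.\<close>

lemma obtain_reflection_word:
  assumes \<pi>: "\<pi> permutes {1..n}"
  obtains ts where "length ts = reflection_length n \<pi>" and "set ts \<subseteq> transpositions n"
    and "\<pi> = word_product ts"
    and "reflection_length n \<pi> + card (components (inversion_graph n \<pi>)) \<le> n"
proof -
  let ?C = "\<lambda>x. reachable n \<pi> `` {x}"
  have "?C (\<pi> x) = ?C x" if "x \<in> {1..n}" for x
    using reachable_image[OF \<pi> that] by (blast intro: reachable_sym reachable_trans)
  then obtain ws where ws: "set ws \<subseteq> transpositions n" "\<pi> = word_product ws"
      "length ws + card (?C ` {1..n}) \<le> n"
    using colour_preserving_permutation_word[of "{1..n}" \<pi> ?C] \<pi>
    unfolding transpositions_eq by auto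
  have "reflection_length n \<pi> \<le> length ws"
    unfolding reflection_length_def ws(2) by (rule word_length_le[OF ws(1)])
  with ws(3) have "reflection_length n \<pi> + card (components (inversion_graph n \<pi>)) \<le> n"
    by (simp add: components_eq_image)
  then show ?thesis
    using obtain_shortest_word[OF ws(1,2)] that unfolding reflection_length_def by blast
qed

section \<open>Two factorizations force many letters\<close>

text \<open>As \<open>p\<close> maps \<open>A\<close> onto itself, \<open>x\<close> and \<open>y\<close> lie in different cycles of \<open>p\<close>, which the
  transposition merges into one, and a colour preserved by the product is constant on that cycle.
  Instead of following a cycle, count the elements of \<open>A\<close> with the colour of \<open>x\<close>. As \<open>p\<close> permutes
  \<open>A\<close>, recolouring \<open>x\<close> with the colour of \<open>y\<close> does not change this number, so nothing was
  recoloured.\<close>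

lemma colours_merge:
  assumes "finite A" and p: "bij_betw p A A" and x: "x \<in> A" and y: "y \<notin> A"
    and pres: "\<And>z. f (transpose x y (p z)) = f z"
  shows "f x = f y"
proof (rule ccontr)
  assume neq: "f x \<noteq> f y"
  let ?same = "{z \<in> A. f z = f x}"
  have "?same = {z \<in> A. f (transpose x y (p z)) = f x}" using pres by simp
  then have "p ` ?same = {w \<in> A. f (transpose x y w) = f x}"
    using p by (auto simp: bij_betw_def)
  also have "\<dots> = ?same - {x}"
    using y neq by (auto simp: transpose_def)
  finally have "card ?same = card (?same - {x})"
    using card_image[of p ?same] inj_on_subset[of p A ?same] p by (simp add: bij_betw_def)
  moreover have "card (?same - {x}) < card ?same"
    using \<open>finite A\<close> x by (intro card_Diff1_less) auto
  ultimately show False by simp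
qed

text \<open>The set \<open>F\<close> collects the letters that occur again later in the word. Once \<open>i\<close> and \<open>i + 1\<close> are
  known to have the same colour for the first letter \<open>i\<close>, the product of the remaining letters
  preserves colours too. If \<open>i\<close> occurs again, this is a hypothesis on \<open>f\<close>; otherwise the remaining
  product maps \<open>{..i}\<close> onto itself, and the first letter merges two cycles.\<close>

lemma repeated_letters_determine_colours:
  "\<exists>F. finite F \<and> card F + card (set idx) \<le> length idx \<and>
      (\<forall>f :: nat \<Rightarrow> 'b. (\<forall>z. f (word_product (map adjacent_swap idx) z) = f z) \<longrightarrow>
        (\<forall>i\<in>F. f i = f (Suc i)) \<longrightarrow> (\<forall>i\<in>set idx. f i = f (Suc i)))"
proof (induction idx)
  case Nil
  show ?case by (intro exI[of _ "{}"]) simp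
next
  case (Cons i idx)
  let ?p = "word_product (map adjacent_swap idx)"
  obtain F where F: "finite F" "card F + card (set idx) \<le> length idx"
    and IH: "\<And>f :: nat \<Rightarrow> 'b. \<forall>z. f (?p z) = f z \<Longrightarrow> \<forall>j\<in>F. f j = f (Suc j) \<Longrightarrow>
      \<forall>j\<in>set idx. f j = f (Suc j)"
    using Cons.IH by blast
  have peel: "\<forall>j\<in>set (i # idx). f j = f (Suc j)"
    if pres: "\<forall>z. f (word_product (map adjacent_swap (i # idx)) z) = f z"
      and "\<forall>j\<in>F. f j = f (Suc j)" and i: "f i = f (Suc i)" for f :: "nat \<Rightarrow> 'b"
  proof -
    have "f (adjacent_swap i w) = f w" for w using i by (simp add: transpose_def)
    with pres have "\<forall>z. f (?p z) = f z" by simp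
    from IH[OF this that(2)] i show ?thesis by simp
  qed
  show ?case
  proof (cases "i \<in> set idx")
    case True
    have "card (insert i F) \<le> Suc (card F)" by (rule card_insert_le_m1) simp_all
    with True F peel show ?thesis
      by (intro exI[of _ "insert i F"]) (simp add: insert_absorb)
  next
    case False
    have merge: "f i = f (Suc i)"
      if "\<forall>z. f (word_product (map adjacent_swap (i # idx)) z) = f z" for f :: "nat \<Rightarrow> 'b"
    proof (rule colours_merge[where p = ?p and A = "{..i}"])
      have inj: "inj_on ?p {..i}"
        using bij_adjacent_swap_product by (auto intro: inj_on_subset dest: bij_is_inj)
      have "?p ` {..i} \<subseteq> {..i}"
        using adjacent_swap_product_le_iff[OF False] by auto
      with inj show "bij_betw ?p {..i} {..i}"
        by (simp add: bij_betw_def endo_inj_surj)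
      show "f (transpose i (Suc i) (?p z)) = f z" for z using that by simp
    qed auto
    show ?thesis
    proof (intro exI[of _ F] conjI allI impI)
      show "finite F" by (rule F(1))
      show "card F + card (set (i # idx)) \<le> length (i # idx)" using F(2) False by simp
      fix f :: "nat \<Rightarrow> 'b"
      assume pres: "\<forall>z. f (word_product (map adjacent_swap (i # idx)) z) = f z"
        and eq: "\<forall>j\<in>F. f j = f (Suc j)"
      show "\<forall>j\<in>set (i # idx). f j = f (Suc j)"
        by (rule peel[OF pres eq merge[OF pres]])
    qed
  qed
qed

text \<open>A graph with \<open>m\<close> edges on \<open>V\<close> has at least \<open>card V - m\<close> components: adding an edge merges at
  most two colour classes.\<close>

lemma obtain_edge_colouring_of_components:
  fixes es :: "('a \<times> 'a) list"
  assumes "finite V"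
  obtains f :: "'a \<Rightarrow> 'a" where "\<forall>(x, y)\<in>set es. f x = f y" and "card V \<le> card (f ` V) + length es"
proof -
  have "\<exists>f :: 'a \<Rightarrow> 'a. (\<forall>(x, y)\<in>set es. f x = f y) \<and> card V \<le> card (f ` V) + length es"
  proof (induction es)
    case Nil
    show ?case by (intro exI[of _ id]) simp
  next
    case (Cons e es)
    obtain x y where e: "e = (x, y)" by force
    from Cons.IH obtain f :: "'a \<Rightarrow> 'a" where f: "\<forall>(x, y)\<in>set es. f x = f y"
      "card V \<le> card (f ` V) + length es" by blast
    define g where "g z = (if f z = f y then f x else f z)" for z
    have "f ` V \<subseteq> insert (f y) (g ` V)" by (auto simp: g_def)
    then have "card (f ` V) \<le> card (insert (f y) (g ` V))"
      using assms by (intro card_mono) auto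
    also have "\<dots> \<le> Suc (card (g ` V))" by (rule card_insert_le_m1) simp_all
    finally have "card V \<le> card (g ` V) + length (e # es)" using f(2) by simp
    moreover have "\<forall>(u, v)\<in>set (e # es). g u = g v" using f(1) by (auto simp: e g_def)
    ultimately show ?case by blast
  qed
  then show ?thesis using that by blast
qed

text \<open>Every colour is already used by an element of \<open>{1..n}\<close> that is not the successor of an element
  of \<open>S\<close>, namely by the least element of that colour.\<close>

lemma card_colours_le:
  assumes S: "S \<subseteq> {1..<n}" and eq: "\<And>i. i \<in> S \<Longrightarrow> f i = f (Suc i)"
  shows "card (f ` {1..n}) + card S \<le> n"
proof -
  have "f x \<in> f ` ({1..n} - Suc ` S)" if "x \<in> {1..n}" for x
    using that
  proof (induction x)
    case (Suc x)
    show ?case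
    proof (cases "x \<in> S")
      case True
      then have "x \<in> {1..n}" using S by auto
      then show ?thesis using Suc.IH eq[OF True] by simp
    next
      case False
      then show ?thesis using Suc.prems by (intro imageI) auto
    qed
  qed simp
  then have "card (f ` {1..n}) \<le> card (f ` ({1..n} - Suc ` S))"
    by (intro card_mono) auto
  also have "\<dots> \<le> card ({1..n} - Suc ` S)" by (rule card_image_le) simp
  also have "\<dots> = n - card S"
  proof -
    have "Suc ` S \<subseteq> {1..n}" using S by auto
    moreover have "finite S" using S by (rule finite_subset) simp
    ultimately show ?thesis by (simp add: card_Diff_subset card_image)
  qed
  finally have "card (f ` {1..n}) \<le> n - card S" .
  moreover have "card S \<le> n"
    using card_mono[OF _ S] by simp
  ultimately show ?thesis by simp
qed

text \<open>With \<open>S\<close> for the set of letters, a colouring by components of the graph formed by all the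
  transpositions and the repeated letters has at most \<open>n - |S|\<close> colours, and at least \<open>n\<close> minus the
  number of edges.\<close>

lemma two_factorizations_bound:
  assumes idx: "set idx \<subseteq> {1..<n}" and ts: "set ts \<subseteq> transpositions n"
    and eq: "word_product (map adjacent_swap idx) = word_product ts"
  shows "2 * card (set idx) \<le> length idx + length ts"
proof -
  have "\<exists>es. length es = length ts \<and> ts = map (\<lambda>(a, b). transpose a b) es"
    using ts
  proof (induction ts)
    case (Cons t ts)
    then obtain es where "length es = length ts" "ts = map (\<lambda>(a, b). transpose a b) es" by auto
    moreover obtain a b where "t = transpose a b"
      using Cons.prems by (auto simp: transpositions_def)
    ultimately show ?case by (intro exI[of _ "(a, b) # es"]) simp
  qed simp
  then obtain es where es: "length es = length ts" "ts = map (\<lambda>(a, b). transpose a b) es" by blast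
  obtain F where F: "finite F" "card F + card (set idx) \<le> length idx"
    and letters: "\<forall>f :: nat \<Rightarrow> nat.
      (\<forall>z. f (word_product (map adjacent_swap idx) z) = f z) \<longrightarrow>
      (\<forall>i\<in>F. f i = f (Suc i)) \<longrightarrow> (\<forall>i\<in>set idx. f i = f (Suc i))"
    using repeated_letters_determine_colours[of idx] by (elim exE conjE)
  let ?es = "es @ map (\<lambda>i. (i, Suc i)) (sorted_list_of_set F)"
  obtain f :: "nat \<Rightarrow> nat" where f: "\<forall>(x, y)\<in>set ?es. f x = f y"
      "card {1..n} \<le> card (f ` {1..n}) + length ?es"
    using obtain_edge_colouring_of_components[of "{1..n}" ?es] by blast
  have "f (t z) = f z" if "t \<in> set ts" for t z
  proof -
    from that es(2) obtain a b where "(a, b) \<in> set es" and t: "t = transpose a b" by auto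
    then have "f a = f b" using f(1) by auto
    then show ?thesis by (simp add: t transpose_def)
  qed
  then have "f (word_product ts z) = f z" for z
    by (induction ts) simp_all
  then have "\<forall>z. f (word_product (map adjacent_swap idx) z) = f z" by (simp add: eq)
  moreover have "\<forall>i\<in>F. f i = f (Suc i)" using f(1) F(1) by auto
  ultimately have "\<forall>i\<in>set idx. f i = f (Suc i)" using letters by blast
  then have "card (f ` {1..n}) + card (set idx) \<le> n"
    using card_colours_le[OF idx] by blast
  with f(2) F es(1) show ?thesis by simp
qed

section \<open>The two inequalities\<close>

theorem corollary1p5:
  fixes n :: nat and \<pi> :: "nat \<Rightarrow> nat"
  assumes "n \<ge> 1" and "\<pi> permutes {1..n}"
  shows "cyclomatic_number (inversion_graph n \<pi>)
           \<le> int (coxeter_length n \<pi>) - int (reflection_length n \<pi>)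
       \<and> int (coxeter_length n \<pi>) - int (reflection_length n \<pi>)
           \<le> 2 * cyclomatic_number (inversion_graph n \<pi>)"
proof -
  obtain idx where idx: "set idx \<subseteq> {1..<n}" "\<pi> = word_product (map adjacent_swap idx)"
      "length idx = coxeter_length n \<pi>" "coxeter_length n \<pi> = card (inversions n (inv \<pi>))"
    using obtain_reduced_word[OF assms(2)] .
  obtain ts where ts: "length ts = reflection_length n \<pi>" "set ts \<subseteq> transpositions n"
      "\<pi> = word_product ts"
      "reflection_length n \<pi> + card (components (inversion_graph n \<pi>)) \<le> n"
    using obtain_reflection_word[OF assms(2)] .
  have "2 * card (set idx) \<le> coxeter_length n \<pi> + reflection_length n \<pi>"
    using two_factorizations_bound[OF idx(1) ts(2)] idx ts by simp
  moreover have "n \<le> card (components (inversion_graph n \<pi>)) + card (set idx)"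
    by (rule card_components_ge[OF idx(2,1)])
  moreover have "cyclomatic_number (inversion_graph n \<pi>)
      = int (coxeter_length n \<pi>) - int n + int (card (components (inversion_graph n \<pi>)))"
    unfolding cyclomatic_number_def card_edges_inversion_graph idx(4)
    by (simp add: inversion_graph_def)
  ultimately show ?thesis using ts(4) by linarith
qed

end
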